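(* Let $U\subseteq\mathbb{R}^d$ be bounded, $c\in L^2(U,\mathbb{C})$ and $w\in W^+(U)$. Then the functional $$L^2(U,\mathbb{C})\times\mathbb{R}^d\to\mathbb{R},\quad (f,t)\mapsto\|f\star_w f-\mu_t c\|_{L^2}^2$$ is weakly lower semi-continuous.
   Context: A superscript $*$ denotes complex conjugation. All subsets of $\mathbb{R}^d$ are assumed Lebesgue measurable. For functions $f,g:\mathbb{R}^d\to\mathbb{C}$ and a weight $w:\mathbb{R}^d\times\mathbb{R}^d\to\mathbb{C}$, the weighted cross-correlation is $(f\star_w g)(x):=\int_{\mathbb{R}^d}f^*(y)g(x+y)w(x+y,y)\,\mathrm{d}y$ for all $x$ such that the integral is well defined and finite; functions on $U$ and weights on $U\times U$ are extended by zero. For $t\in\mathbb{R}^d$, $\mu_t:\mathbb{R}^d\to\mathbb{C}$, $\mu_t(x):=e^{2\pi i x\cdot t}$. The $L^2$ norm is over $\mathbb{R}^d$. $W(U)$ is the set of measurable and bounded functions $w:U\times U\to\mathbb{C}$. $W^+(U)$ is the set of $w\in W(U)$ for which there exist, for every $N\in\mathbb{N}$, a function $w_N\in W(U)$ and measurable bounded functions $v_{1,N},\ldots,v_{N,N}:U\to\mathbb{C}$ with $w_N(x,y)=\sum_{j=1}^N v_{j,N}(x)v_{j,N}^*(y)$ for all $x,y\in U$, such that $\lim_{N\to\infty}\|w-w_N\|_\infty=0$. Weak lower semi-continuity is understood sequentially: $F$ is weakly lower semi-continuous if $F(f,t)\le\liminf_{n\to\infty}F(f_n,t_n)$ whenever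 $(f_n,t_n)\rightharpoonup(f,t)$ weakly. *)

theory Defs
  imports "HOL-Analysis.Analysis" "HOL-Probability.Essential_Supremum"
begin

text \<open>
  A function on a set \<open>U\<close> is represented by its extension by zero to the whole space, and a
  function on \<open>U \<times> U\<close> likewise. Elements of \<open>L\<^sup>2\<close> are represented by functions rather than by
  classes of functions; what is defined for them below does not see changes on null sets.
  Measurability is Lebesgue measurability throughout.
\<close>

definition L2 :: "'a::euclidean_space set \<Rightarrow> ('a \<Rightarrow> complex) set" where
  "L2 U = {f. f \<in> borel_measurable lebesgue \<and> integrable lebesgue (\<lambda>x. (cmod (f x))\<^sup>2)
              \<and> (\<forall>x. x \<notin> U \<longrightarrow> f x = 0)}"

definition L2_norm :: "('a::euclidean_space \<Rightarrow> complex) \<Rightarrow> real" where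
  "L2_norm f = sqrt (\<integral>x. (cmod (f x))\<^sup>2 \<partial>lebesgue)"

definition bounded_measurable :: "'a::euclidean_space set \<Rightarrow> ('a \<Rightarrow> complex) set" where
  "bounded_measurable A =
     {v. v \<in> borel_measurable lebesgue \<and> bounded (range v) \<and> (\<forall>x. x \<notin> A \<longrightarrow> v x = 0)}"

definition W :: "'a::euclidean_space set \<Rightarrow> ('a \<Rightarrow> 'a \<Rightarrow> complex) set" where
  "W U = {w. (\<lambda>(x, y). w x y) \<in> bounded_measurable (U \<times> U)}"

text \<open>
  The supremum norm is read as the essential supremum. As uniform convergence implies convergence
  in this norm, the set \<open>W_plus U\<close> contains every weight that the pointwise supremum would give.
\<close>

definition sup_norm :: "('a::euclidean_space \<Rightarrow> 'a \<Rightarrow> complex) \<Rightarrow> ereal" where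
  "sup_norm w = esssup lebesgue (\<lambda>(x, y). ereal (cmod (w x y)))"

definition W_plus :: "'a::euclidean_space set \<Rightarrow> ('a \<Rightarrow> 'a \<Rightarrow> complex) set" where
  "W_plus U = {w \<in> W U. \<exists>wN v.
      (\<forall>N. wN N \<in> W U \<and> (\<forall>j\<in>{1..N}. v N j \<in> bounded_measurable U)
           \<and> (\<forall>x\<in>U. \<forall>y\<in>U. wN N x y = (\<Sum>j=1..N. v N j x * cnj (v N j y))))
      \<and> (\<lambda>N::nat. sup_norm (\<lambda>x y. w x y - wN N x y)) \<longlonglongrightarrow> 0}"

definition xcorr_integrand ::
    "('a::euclidean_space \<Rightarrow> 'a \<Rightarrow> complex) \<Rightarrow> ('a \<Rightarrow> complex) \<Rightarrow> ('a \<Rightarrow> complex) \<Rightarrow> 'a \<Rightarrow> 'a \<Rightarrow> complex" where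
  "xcorr_integrand w f g x y = cnj (f y) * g (x + y) * w (x + y) y"

text \<open>
  Where the integral does not exist, the value of \<open>xcorr\<close> is the library's default 0. For the
  weights and functions of interest this happens on a null set only.
\<close>

definition xcorr ::
    "('a::euclidean_space \<Rightarrow> 'a \<Rightarrow> complex) \<Rightarrow> ('a \<Rightarrow> complex) \<Rightarrow> ('a \<Rightarrow> complex) \<Rightarrow> 'a \<Rightarrow> complex" where
  "xcorr w f g x = (\<integral>y. xcorr_integrand w f g x y \<partial>lebesgue)"

definition \<mu> :: "'a::euclidean_space \<Rightarrow> 'a \<Rightarrow> complex" where
  "\<mu> t x = exp (2 * of_real pi * \<i> * of_real (x \<bullet> t))"

definition residual ::
    "('a::euclidean_space \<Rightarrow> 'a \<Rightarrow> complex) \<Rightarrow> ('a \<Rightarrow> complex) \<Rightarrow> ('a \<Rightarrow> complex) \<Rightarrow> 'a \<Rightarrow> 'a \<Rightarrow> complex" where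
  "residual w c f t = (\<lambda>x. xcorr w f f x - \<mu> t x * c x)"

text \<open>
  Bounded linear functionals on the Hilbert space \<open>L\<^sup>2(U) \<times> \<real>\<^sup>d\<close>, which is a space over the reals
  because the second factor is.
\<close>

definition bounded_functional ::
    "'a::euclidean_space set \<Rightarrow> (('a \<Rightarrow> complex) \<times> 'a \<Rightarrow> real) \<Rightarrow> bool" where
  "bounded_functional U \<phi> \<longleftrightarrow>
     (\<forall>f\<in>L2 U. \<forall>g\<in>L2 U. \<forall>s t. \<phi> (\<lambda>x. f x + g x, s + t) = \<phi> (f, s) + \<phi> (g, t)) \<and>
     (\<forall>f\<in>L2 U. \<forall>t. \<forall>a::real. \<phi> (\<lambda>x. of_real a * f x, a *\<^sub>R t) = a * \<phi> (f, t)) \<and>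
     (\<exists>K. \<forall>f\<in>L2 U. \<forall>t. \<bar>\<phi> (f, t)\<bar> \<le> K * sqrt ((L2_norm f)\<^sup>2 + (norm t)\<^sup>2))"

definition weakly_converges ::
    "'a::euclidean_space set \<Rightarrow> (nat \<Rightarrow> ('a \<Rightarrow> complex) \<times> 'a) \<Rightarrow> ('a \<Rightarrow> complex) \<times> 'a \<Rightarrow> bool" where
  "weakly_converges U p q \<longleftrightarrow> (\<forall>\<phi>. bounded_functional U \<phi> \<longrightarrow> (\<lambda>n. \<phi> (p n)) \<longlonglongrightarrow> \<phi> q)"

definition weakly_lsc ::
    "'a::euclidean_space set \<Rightarrow> (('a \<Rightarrow> complex) \<times> 'a \<Rightarrow> real) \<Rightarrow> bool" where
  "weakly_lsc U F \<longleftrightarrow>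
     (\<forall>p q. (\<forall>n. p n \<in> L2 U \<times> UNIV) \<longrightarrow> q \<in> L2 U \<times> UNIV \<longrightarrow> weakly_converges U p q \<longrightarrow>
        ereal (F q) \<le> liminf (\<lambda>n. ereal (F (p n))))"

end

theory Submission
  imports Defs
begin

text \<open>
  Let \<open>r\<close> be the residual at the weak limit \<open>(f, t)\<close> and \<open>r\<^sub>n\<close> the residual at \<open>(f\<^sub>n, t\<^sub>n)\<close>. Since
  \<open>\<parallel>r\<^sub>n\<parallel>\<^sup>2 \<ge> 2 Re \<langle>r, r\<^sub>n\<rangle> - \<parallel>r\<parallel>\<^sup>2\<close>, weak lower semicontinuity follows once \<open>\<langle>r, r\<^sub>n\<rangle>\<close> tends to \<open>\<langle>r, r\<rangle>\<close>,
  because the right-hand side then tends to \<open>\<parallel>r\<parallel>\<^sup>2\<close>. The residual has two parts. The modulated part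
  is harmless: weak convergence in the second, finite-dimensional factor is convergence, and dominated
  convergence applies to \<open>\<langle>r, \<mu> t\<^sub>n c\<rangle>\<close>.

  For the correlation part, substitute \<open>z = x + y\<close> in the double integral:
  \<open>\<langle>r, f \<star>\<^sub>w f\<rangle> = \<integral>\<integral> f z * cnj (f y) * k (z, y) dy dz\<close> with \<open>k (z, y) = cnj (r (z - y)) * w z y\<close>.
  As \<open>w\<close> is bounded and lives on a bounded set, \<open>k\<close> is square integrable (\<open>xcorr_pairing_kernel\<close>), so this
  is a Hilbert-Schmidt form in \<open>f\<close>. Such a form is continuous along weakly convergent sequences
  (\<open>Hilbert_Schmidt_form_tendsto\<close>), because the Hilbert-Schmidt operator is compact: it maps a bounded
  weakly convergent sequence to a strongly convergent one, here by pointwise convergence and domination.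

  The domination needs norm bounds for the \<open>f\<^sub>n\<close>, that is, the uniform boundedness principle
  (\<open>weakly_convergent_bounded\<close>). It is proved by a gliding hump in the dual space: the hump is
  a series of functionals, whose sum is defined pointwise by an absolutely convergent series of numbers
  (\<open>bounded_functional_series\<close>).

  Fubini's theorem is applied to Borel functions only. Lebesgue measurable functions are therefore
  replaced by Borel functions equal to them almost everywhere. The correlation sees \<open>w\<close> along
  \<open>(x, y) \<mapsto> (x + y, y)\<close>, and as this shear preserves Lebesgue measure (\<open>distr_shear\<close>), the
  replacement changes the correlation on a null set only (\<open>xcorr_representative\<close>).
\<close>

section \<open>Square-integrable functions\<close>

definition square_integrable :: "'a measure \<Rightarrow> ('a \<Rightarrow> complex) \<Rightarrow> bool" where
  "square_integrable M f \<longleftrightarrow> f \<in> borel_measurable M \<and> integrable M (\<lambda>x. (cmod (f x))\<^sup>2)"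

definition l2_norm :: "'a measure \<Rightarrow> ('a \<Rightarrow> complex) \<Rightarrow> real" where
  "l2_norm M f = sqrt (\<integral>x. (cmod (f x))\<^sup>2 \<partial>M)"

lemma square_integrableD [dest]:
  assumes "square_integrable M f"
  shows "f \<in> borel_measurable M" "integrable M (\<lambda>x. (cmod (f x))\<^sup>2)"
  using assms by (auto simp: square_integrable_def)

lemma l2_norm_nonneg [simp]: "0 \<le> l2_norm M f"
  by (simp add: l2_norm_def)

lemma l2_norm_power2: "(l2_norm M f)\<^sup>2 = (\<integral>x. (cmod (f x))\<^sup>2 \<partial>M)"
  by (simp add: l2_norm_def)

lemma l2_norm_cnj [simp]: "l2_norm M (\<lambda>x. cnj (f x)) = l2_norm M f"
  by (simp add: l2_norm_def)

lemma borel_measurable_cnj [measurable]: "cnj \<in> borel_measurable borel"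
  by (intro borel_measurable_continuous_onI continuous_intros)

lemma square_integrable_cnj:
  assumes "square_integrable M f"
  shows "square_integrable M (\<lambda>x. cnj (f x))"
proof -
  have [measurable]: "f \<in> borel_measurable M"
    using assms by auto
  have "(\<lambda>x. cnj (f x)) \<in> borel_measurable M"
    by measurable
  then show ?thesis
    using assms by (simp add: square_integrable_def)
qed

lemma square_integrable_bound:
  assumes "square_integrable M g" and "f \<in> borel_measurable M"
    and "AE x in M. cmod (f x) \<le> K * cmod (g x)"
  shows "square_integrable M f"
  unfolding square_integrable_def
proof
  show "f \<in> borel_measurable M" by fact
  have "integrable M (\<lambda>x. K\<^sup>2 * (cmod (g x))\<^sup>2)"
    using assms(1) by (intro integrable_mult_right) auto
  then show "integrable M (\<lambda>x. (cmod (f x))\<^sup>2)"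
  proof (rule Bochner_Integration.integrable_bound)
    show "(\<lambda>x. (cmod (f x))\<^sup>2) \<in> borel_measurable M"
      using assms(2) by measurable
    show "AE x in M. norm ((cmod (f x))\<^sup>2) \<le> norm (K\<^sup>2 * (cmod (g x))\<^sup>2)"
      using assms(3)
    proof eventually_elim
      case (elim x)
      then have "(cmod (f x))\<^sup>2 \<le> (K * cmod (g x))\<^sup>2"
        by (intro power_mono) auto
      then show ?case
        by (simp add: power_mult_distrib)
    qed
  qed
qed

lemma l2_norm_bound:
  assumes "square_integrable M g" and "f \<in> borel_measurable M" and "0 \<le> K"
    and le: "AE x in M. cmod (f x) \<le> K * cmod (g x)"
  shows "l2_norm M f \<le> K * l2_norm M g"
proof (rule power2_le_imp_le)
  have "(\<integral>x. (cmod (f x))\<^sup>2 \<partial>M) \<le> (\<integral>x. (K * cmod (g x))\<^sup>2 \<partial>M)"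
  proof (rule integral_mono_AE)
    show "integrable M (\<lambda>x. (cmod (f x))\<^sup>2)"
      using square_integrable_bound[OF assms(1,2) le] by auto
    show "integrable M (\<lambda>x. (K * cmod (g x))\<^sup>2)"
      using assms(1) by (auto simp: power_mult_distrib)
    show "AE x in M. (cmod (f x))\<^sup>2 \<le> (K * cmod (g x))\<^sup>2"
      using le by eventually_elim (rule power_mono, auto)
  qed
  then show "(l2_norm M f)\<^sup>2 \<le> (K * l2_norm M g)\<^sup>2"
    by (simp add: l2_norm_power2 power_mult_distrib)
qed (use assms in auto)

lemma square_integrable_cmult:
  assumes "square_integrable M f"
  shows "square_integrable M (\<lambda>x. a * f x)"
  by (rule square_integrable_bound[where K = "cmod a", OF assms])
     (use assms in \<open>auto simp: norm_mult intro!: borel_measurable_times\<close>)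

lemma power2_norm_add_le: "(norm (a + b))\<^sup>2 \<le> 2 * (norm a)\<^sup>2 + 2 * (norm b)\<^sup>2"
  for a b :: "'a::real_normed_vector"
proof -
  have "(norm (a + b))\<^sup>2 \<le> (norm a + norm b)\<^sup>2"
    by (intro power_mono norm_triangle_ineq) auto
  also have "\<dots> \<le> 2 * (norm a)\<^sup>2 + 2 * (norm b)\<^sup>2"
    using sum_squares_bound[of "norm a" "norm b"] by (simp add: power2_sum)
  finally show ?thesis .
qed

lemma square_integrable_add:
  assumes f: "square_integrable M f" and g: "square_integrable M g"
  shows "square_integrable M (\<lambda>x. f x + g x)"
  unfolding square_integrable_def
proof
  have [measurable]: "f \<in> borel_measurable M" "g \<in> borel_measurable M"
    using assms by auto
  show "(\<lambda>x. f x + g x) \<in> borel_measurable M"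
    by measurable
  have "integrable M (\<lambda>x. 2 * (cmod (f x))\<^sup>2 + 2 * (cmod (g x))\<^sup>2)"
    using f g by (intro Bochner_Integration.integrable_add integrable_mult_right) auto
  then show "integrable M (\<lambda>x. (cmod (f x + g x))\<^sup>2)"
    by (rule Bochner_Integration.integrable_bound)
       (auto intro!: AE_I2 simp: power2_norm_add_le abs_of_nonneg)
qed

lemma square_integrable_diff:
  assumes "square_integrable M f" and "square_integrable M g"
  shows "square_integrable M (\<lambda>x. f x - g x)"
  using square_integrable_add[OF assms(1) square_integrable_cmult[OF assms(2), of "-1"]] by simp

lemma square_integrable_times:
  assumes f: "square_integrable M f" and g: "square_integrable M g"
  shows "integrable M (\<lambda>x. f x * g x)"
proof -
  have [measurable]: "f \<in> borel_measurable M" "g \<in> borel_measurable M"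
    using assms by auto
  have "integrable M (\<lambda>x. (cmod (f x))\<^sup>2 + (cmod (g x))\<^sup>2)"
    using f g by auto
  then show ?thesis
  proof (rule Bochner_Integration.integrable_bound)
    have "cmod (f x) * cmod (g x) \<le> (cmod (f x))\<^sup>2 + (cmod (g x))\<^sup>2" for x
      using sum_squares_bound[of "cmod (f x)" "cmod (g x)"]
        mult_nonneg_nonneg[OF norm_ge_zero norm_ge_zero, of "f x" "g x"] by linarith
    then show "AE x in M. norm (f x * g x) \<le> norm ((cmod (f x))\<^sup>2 + (cmod (g x))\<^sup>2)"
      by (auto simp: norm_mult)
  qed measurable
qed

lemma integral_Cauchy_Schwarz:
  assumes f: "square_integrable M f" and g: "square_integrable M g"
  shows "cmod (\<integral>x. f x * g x \<partial>M) \<le> l2_norm M f * l2_norm M g"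
proof -
  have [measurable]: "f \<in> borel_measurable M" "g \<in> borel_measurable M"
    using assms by auto
  define I where "I = (\<integral>x. cmod (f x) * cmod (g x) \<partial>M)"
  have int: "integrable M (\<lambda>x. cmod (f x) * cmod (g x))"
    using integrable_norm[OF square_integrable_times[OF f g]] by (simp add: norm_mult)
  have "(\<integral>\<^sup>+x. ennreal (cmod (f x)) * ennreal (cmod (g x)) \<partial>M)\<^sup>2
      \<le> (\<integral>\<^sup>+x. (ennreal (cmod (f x)))\<^sup>2 \<partial>M) * (\<integral>\<^sup>+x. (ennreal (cmod (g x)))\<^sup>2 \<partial>M)"
    by (rule Cauchy_Schwarz_nn_integral) auto
  also have "(\<integral>\<^sup>+x. ennreal (cmod (f x)) * ennreal (cmod (g x)) \<partial>M) = ennreal I"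
    unfolding I_def using nn_integral_eq_integral[OF int] by (simp add: ennreal_mult)
  also have "(\<integral>\<^sup>+x. (ennreal (cmod (f x)))\<^sup>2 \<partial>M) = ennreal ((l2_norm M f)\<^sup>2)"
    using nn_integral_eq_integral[OF square_integrableD(2)[OF f]]
    by (simp add: ennreal_power l2_norm_power2)
  also have "(\<integral>\<^sup>+x. (ennreal (cmod (g x)))\<^sup>2 \<partial>M) = ennreal ((l2_norm M g)\<^sup>2)"
    using nn_integral_eq_integral[OF square_integrableD(2)[OF g]]
    by (simp add: ennreal_power l2_norm_power2)
  also have "ennreal ((l2_norm M f)\<^sup>2) * ennreal ((l2_norm M g)\<^sup>2)
      = ennreal ((l2_norm M f * l2_norm M g)\<^sup>2)"
    by (simp add: ennreal_mult power_mult_distrib)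
  finally have "I\<^sup>2 \<le> (l2_norm M f * l2_norm M g)\<^sup>2"
    by (simp add: ennreal_power I_def)
  then have "I \<le> l2_norm M f * l2_norm M g"
    by (rule power2_le_imp_le) simp
  moreover have "cmod (\<integral>x. f x * g x \<partial>M) \<le> I"
    unfolding I_def using integral_norm_bound[of M "\<lambda>x. f x * g x"] by (simp add: norm_mult)
  ultimately show ?thesis by simp
qed

text \<open>
  This is \<open>\<parallel>f - r\<parallel>\<^sup>2 \<ge> 0\<close>, arranged as a lower bound for \<open>\<parallel>f\<parallel>\<^sup>2\<close> that is affine in \<open>f\<close> and attained at
  \<open>f = r\<close>; affine minorants pass to weak limits.
\<close>

lemma l2_norm_power2_lower_bound:
  assumes f: "square_integrable M f" and r: "square_integrable M r"
  shows "2 * Re (\<integral>x. cnj (r x) * f x \<partial>M) - (l2_norm M r)\<^sup>2 \<le> (l2_norm M f)\<^sup>2"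
proof -
  have int: "integrable M (\<lambda>x. cnj (r x) * f x)"
    by (intro square_integrable_times square_integrable_cnj f r)
  have "2 * Re (\<integral>x. cnj (r x) * f x \<partial>M) = (\<integral>x. 2 * Re (cnj (r x) * f x) \<partial>M)"
    unfolding integral_mult_right_zero using integral_Re[OF int] by (simp only:)
  then have "2 * Re (\<integral>x. cnj (r x) * f x \<partial>M) - (l2_norm M r)\<^sup>2
      = (\<integral>x. 2 * Re (cnj (r x) * f x) - (cmod (r x))\<^sup>2 \<partial>M)"
    unfolding l2_norm_power2 using int r
    by (subst Bochner_Integration.integral_diff) (auto simp del: times_complex.sel)
  also have "\<dots> \<le> (\<integral>x. (cmod (f x))\<^sup>2 \<partial>M)"
  proof (rule integral_mono)
    show "integrable M (\<lambda>x. 2 * Re (cnj (r x) * f x) - (cmod (r x))\<^sup>2)"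
      using int r by (intro Bochner_Integration.integrable_diff integrable_mult_right integrable_Re) auto
    show "integrable M (\<lambda>x. (cmod (f x))\<^sup>2)"
      using f by auto
    have "2 * (a * c + b * d) \<le> c\<^sup>2 + d\<^sup>2 + (a\<^sup>2 + b\<^sup>2)" for a b c d :: real
      using sum_squares_bound[of a c] sum_squares_bound[of b d] by (simp add: algebra_simps)
    from this[of "Re (r x)" "Re (f x)" "Im (r x)" "Im (f x)" for x]
    show "2 * Re (cnj (r x) * f x) - (cmod (r x))\<^sup>2 \<le> (cmod (f x))\<^sup>2" for x
      by (simp add: cmod_power2 algebra_simps)
  qed
  finally show ?thesis
    by (simp add: l2_norm_power2)
qed

lemma Re_integral_cnj_self: "Re (\<integral>x. cnj (r x) * r x \<partial>M) = (l2_norm M r)\<^sup>2"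
proof -
  have "cnj (r x) * r x = of_real ((cmod (r x))\<^sup>2)" for x
    unfolding complex_norm_square by (rule mult.commute)
  then show ?thesis
    by (simp only: integral_complex_of_real l2_norm_power2 Re_complex_of_real)
qed


section \<open>Weakly convergent sequences\<close>

lemma L2_iff_square_integrable:
  "f \<in> L2 U \<longleftrightarrow> square_integrable lebesgue f \<and> (\<forall>x. x \<notin> U \<longrightarrow> f x = 0)"
  by (auto simp: L2_def square_integrable_def)

lemma L2_norm_eq: "L2_norm f = l2_norm lebesgue f"
  by (simp add: L2_norm_def l2_norm_def)

lemma bounded_functional_snd: "bounded_functional U (\<lambda>p. snd p \<bullet> b)"
  unfolding bounded_functional_def
proof (intro conjI ballI allI exI)
  fix f :: "'a \<Rightarrow> complex" and t :: 'a
  have "\<bar>t \<bullet> b\<bar> \<le> norm t * norm b"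
    by (rule Cauchy_Schwarz_ineq2)
  also have "\<dots> \<le> sqrt ((L2_norm f)\<^sup>2 + (norm t)\<^sup>2) * norm b"
    by (intro mult_right_mono real_le_rsqrt) auto
  finally show "\<bar>snd (f, t) \<bullet> b\<bar> \<le> norm b * sqrt ((L2_norm f)\<^sup>2 + (norm t)\<^sup>2)"
    by (simp add: mult.commute)
qed (auto simp: inner_add_left)

lemma weakly_converges_snd:
  assumes "weakly_converges U p q"
  shows "(\<lambda>n. snd (p n)) \<longlonglongrightarrow> snd q"
proof -
  have *: "(\<lambda>n. snd (p n) \<bullet> b) \<longlonglongrightarrow> snd q \<bullet> b" for b
    using assms bounded_functional_snd[of U b] unfolding weakly_converges_def by blast
  then have "(\<lambda>n. \<Sum>b\<in>Basis. (snd (p n) \<bullet> b) *\<^sub>R b) \<longlonglongrightarrow> (\<Sum>b\<in>Basis. (snd q \<bullet> b) *\<^sub>R b)"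
    by (intro tendsto_sum tendsto_scaleR tendsto_const *)
  then show ?thesis
    by (simp add: euclidean_representation)
qed

text \<open>
  Each \<open>h j\<close> defines a functional of norm at most \<open>L\<close>, so at every point the series of numbers
  converges absolutely, and the sum has norm at most \<open>(\<Sum>j. \<bar>a j\<bar>) * L\<close>.
\<close>

lemma bounded_functional_series:
  assumes h: "\<And>j. square_integrable lebesgue (h j)" and norm: "\<And>j. l2_norm lebesgue (h j) \<le> L"
    and a: "summable (\<lambda>j. \<bar>a j\<bar>)"
  shows "bounded_functional U (\<lambda>p. \<Sum>j. a j * Re (\<integral>x. h j x * fst p x \<partial>lebesgue))"
proof -
  define T where "T j f = Re (\<integral>x. h j x * f x \<partial>lebesgue)" for j f
  have T_bound: "\<bar>T j f\<bar> \<le> L * l2_norm lebesgue f" if "square_integrable lebesgue f" for j f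
  proof -
    have "\<bar>T j f\<bar> \<le> l2_norm lebesgue (h j) * l2_norm lebesgue f"
      unfolding T_def using abs_Re_le_cmod integral_Cauchy_Schwarz[OF h that] by (rule order_trans)
    also have "\<dots> \<le> L * l2_norm lebesgue f"
      by (intro mult_right_mono norm) auto
    finally show ?thesis .
  qed
  have term_bound: "\<bar>a j * T j f\<bar> \<le> \<bar>a j\<bar> * (L * l2_norm lebesgue f)"
    if "square_integrable lebesgue f" for j f
    using T_bound[OF that, of j] by (simp add: abs_mult mult_left_mono)
  have abs_summable: "summable (\<lambda>j. \<bar>a j * T j f\<bar>)" if "square_integrable lebesgue f" for f
    by (rule summable_comparison_test'[OF summable_mult2[OF a], of 0 _ "L * l2_norm lebesgue f"])
       (use term_bound[OF that] in auto)
  note summable = summable_rabs_cancel[OF abs_summable]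
  have "bounded_functional U (\<lambda>p. \<Sum>j. a j * T j (fst p))"
    unfolding bounded_functional_def fst_conv
  proof (intro conjI ballI allI exI)
    fix f g :: "'a \<Rightarrow> complex" and s t :: 'a
    assume "f \<in> L2 U" "g \<in> L2 U"
    then have f: "square_integrable lebesgue f" and g: "square_integrable lebesgue g"
      by (auto simp: L2_iff_square_integrable)
    have "T j (\<lambda>x. f x + g x) = T j f + T j g" for j
      unfolding T_def
      using square_integrable_times[OF h f, of j] square_integrable_times[OF h g, of j]
      by (simp add: distrib_left)
    then show "(\<Sum>j. a j * T j (\<lambda>x. f x + g x)) = (\<Sum>j. a j * T j f) + (\<Sum>j. a j * T j g)"
      using suminf_add[OF summable[OF f] summable[OF g]] by (simp add: distrib_left)
  next
    fix f :: "'a \<Rightarrow> complex" and t :: 'a and r :: real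
    assume "f \<in> L2 U"
    then have f: "square_integrable lebesgue f"
      by (auto simp: L2_iff_square_integrable)
    have "T j (\<lambda>x. of_real r * f x) = r * T j f" for j
      unfolding T_def by (simp add: mult.left_commute)
    then show "(\<Sum>j. a j * T j (\<lambda>x. of_real r * f x)) = r * (\<Sum>j. a j * T j f)"
      using suminf_mult[OF summable[OF f], of r] by (simp add: mult.left_commute)
  next
    fix f :: "'a \<Rightarrow> complex" and t :: 'a
    assume "f \<in> L2 U"
    then have f: "square_integrable lebesgue f"
      by (auto simp: L2_iff_square_integrable)
    have "\<bar>\<Sum>j. a j * T j f\<bar> \<le> (\<Sum>j. \<bar>a j * T j f\<bar>)"
      by (rule summable_rabs[OF abs_summable[OF f]])
    also have "\<dots> \<le> (\<Sum>j. \<bar>a j\<bar> * (L * l2_norm lebesgue f))"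
      by (intro suminf_le term_bound f abs_summable summable_mult2 a)
    also have "\<dots> = (\<Sum>j. \<bar>a j\<bar>) * L * L2_norm f"
      by (simp add: suminf_mult2[OF a, symmetric] L2_norm_eq)
    also have "\<dots> \<le> (\<Sum>j. \<bar>a j\<bar>) * L * sqrt ((L2_norm f)\<^sup>2 + (norm t)\<^sup>2)"
      by (intro mult_left_mono real_le_rsqrt mult_nonneg_nonneg suminf_nonneg a
          order_trans[OF l2_norm_nonneg norm]) auto
    finally show "\<bar>\<Sum>j. a j * T j f\<bar> \<le> (\<Sum>j. \<bar>a j\<bar>) * L * sqrt ((L2_norm f)\<^sup>2 + (norm t)\<^sup>2)" .
  qed
  then show ?thesis
    by (simp add: T_def)
qed

lemma weakly_converges_pairing:
  assumes conv: "weakly_converges U p q" and h: "square_integrable lebesgue h"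
  shows "(\<lambda>n. \<integral>x. h x * fst (p n) x \<partial>lebesgue) \<longlonglongrightarrow> (\<integral>x. h x * fst q x \<partial>lebesgue)"
proof -
  have *: "(\<lambda>n. Re (\<integral>x. g x * fst (p n) x \<partial>lebesgue)) \<longlonglongrightarrow> Re (\<integral>x. g x * fst q x \<partial>lebesgue)"
    if g: "square_integrable lebesgue g" for g
  proof -
    have "bounded_functional U
        (\<lambda>p. \<Sum>j. (if j = 0 then 1 else 0) * Re (\<integral>x. g x * fst p x \<partial>lebesgue))"
      by (rule bounded_functional_series[OF g order_refl]) (auto intro: summable_finite[of "{0}"])
    moreover have "(\<Sum>j::nat. (if j = 0 then 1 else 0) * r) = r" for r :: real
      by (subst suminf_finite[of "{0}"]) auto
    ultimately show ?thesis
      using conv[unfolded weakly_converges_def, rule_format,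
          of "\<lambda>p. Re (\<integral>x. g x * fst p x \<partial>lebesgue)"] by simp
  qed
  have Im_eq: "Im (\<integral>x. h x * f x \<partial>lebesgue) = Re (\<integral>x. (- \<i> * h x) * f x \<partial>lebesgue)" for f
  proof -
    have "(\<integral>x. (- \<i> * h x) * f x \<partial>lebesgue) = - \<i> * (\<integral>x. h x * f x \<partial>lebesgue)"
      unfolding mult.assoc by (rule integral_mult_right_zero)
    then show ?thesis by simp
  qed
  show ?thesis
    unfolding tendsto_complex_iff Im_eq
    using *[OF h] *[OF square_integrable_cmult[OF h, of "- \<i>"]] by simp
qed

text \<open>
  The sign \<open>s k\<close> is chosen after the earlier ones, so that the new term pushes the partial sum
  \<open>\<Sum>j<k. s j * b j k / 3 ^ j\<close> away from zero.
\<close>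

lemma reinforcing_sign_choice:
  fixes b :: "nat \<Rightarrow> nat \<Rightarrow> real"
  obtains s :: "nat \<Rightarrow> real"
  where "\<And>j. \<bar>s j\<bar> = 1" and "\<And>k. \<bar>b k k\<bar> / 3 ^ k \<le> \<bar>\<Sum>j\<le>k. s j * b j k / 3 ^ j\<bar>"
proof -
  define step where
    "step s k = (if (\<Sum>j<k. s j * b j k / 3 ^ j) * b k k \<ge> 0 then 1 else - 1 :: real)" for s k
  define s where "s = wfrec less_than step"
  have s: "s k = step s k" for k
  proof -
    have "adm_wf less_than step"
      by (auto simp: adm_wf_def step_def intro!: if_cong)
    then show ?thesis
      unfolding s_def by (rule wfrec_fixpoint[OF wf_less_than, THEN fun_cong])
  qed
  show thesis
  proof
    show "\<bar>s j\<bar> = 1" for j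
      by (subst s) (simp add: step_def)
    show "\<bar>b k k\<bar> / 3 ^ k \<le> \<bar>\<Sum>j\<le>k. s j * b j k / 3 ^ j\<bar>" for k
    proof -
      define A where "A = (\<Sum>j<k. s j * b j k / 3 ^ j)"
      have *: "\<bar>a\<bar> \<le> \<bar>A + (if A * a \<ge> 0 then 1 else -1) * a\<bar>" for a
        by (cases A "0::real" rule: linorder_cases; cases a "0::real" rule: linorder_cases)
           (auto simp: zero_le_mult_iff)
      have "(\<Sum>j\<le>k. s j * b j k / 3 ^ j) = A + s k * b k k / 3 ^ k"
        by (simp add: A_def lessThan_Suc_atMost[symmetric])
      also have "\<dots> = A + (if A * (b k k / 3 ^ k) \<ge> 0 then 1 else -1) * (b k k / 3 ^ k)"
      proof -
        have "0 \<le> A * (b k k / 3 ^ k) \<longleftrightarrow> 0 \<le> A * b k k"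
          using pos_le_divide_eq[of "3 ^ k" 0 "A * b k k"] by simp
        then show ?thesis
          by (subst s) (simp add: step_def A_def[symmetric])
      qed
      finally show ?thesis
        using *[of "b k k / 3 ^ k"] by simp
    qed
  qed
qed

text \<open>
  If the norms were unbounded, there would be members \<open>F k\<close> of the sequence with norms
  \<open>\<nu> k > 2 * k * 3 ^ k\<close>.
  Consider the functionals \<open>\<langle>F j / \<nu> j, \<cdot>\<rangle>\<close> of norm one with weights \<open>\<plusminus>1 / 3 ^ j\<close>. At \<open>F k\<close> the terms up
  to \<open>k\<close>, with well chosen signs, contribute at least \<open>\<nu> k / 3 ^ k\<close>. The later terms contribute at
  most half of that, since \<open>\<Sum>j>k. 1 / 3 ^ j = 1 / (2 * 3 ^ k)\<close>. So the sum of the series is a bounded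
  functional that is unbounded along the sequence.
\<close>

lemma weakly_convergent_bounded:
  assumes p: "\<And>n. fst (p n) \<in> L2 U" and conv: "weakly_converges U p q"
  obtains K where "\<And>n. l2_norm lebesgue (fst (p n)) \<le> K"
proof (rule ccontr)
  assume "\<not> thesis"
  then have "\<exists>n. 2 * real k * 3 ^ k < l2_norm lebesgue (fst (p n))" for k
    using that by (meson not_le)
  then obtain N where N: "\<And>k. 2 * real k * 3 ^ k < l2_norm lebesgue (fst (p (N k)))"
    by metis
  define F where "F k = fst (p (N k))" for k
  define \<nu> where "\<nu> k = l2_norm lebesgue (F k)" for k
  have F: "square_integrable lebesgue (F k)" for k
    using p by (simp add: F_def L2_iff_square_integrable)
  have \<nu>_large: "2 * real k * 3 ^ k < \<nu> k" for k
    using N by (simp add: \<nu>_def F_def)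
  have \<nu>_pos: "0 < \<nu> k" for k
    using \<nu>_large[of k] by (rule le_less_trans[rotated]) auto
  define h where "h k = (\<lambda>x. of_real (1 / \<nu> k) * cnj (F k x))" for k
  have h: "square_integrable lebesgue (h k)" for k
    unfolding h_def by (intro square_integrable_cmult square_integrable_cnj F)
  have h_norm: "l2_norm lebesgue (h k) \<le> 1" for k
  proof -
    have "(l2_norm lebesgue (h k))\<^sup>2 = (1 / \<nu> k)\<^sup>2 * (\<nu> k)\<^sup>2"
      unfolding \<nu>_def[of k] l2_norm_power2 h_def
      using \<nu>_pos[of k] by (simp add: norm_divide power_divide l2_norm_power2)
    also have "\<dots> = 1\<^sup>2"
      using \<nu>_pos[of k] by (simp add: power_divide)
    finally show ?thesis
      by (auto simp: power2_eq_1_iff)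
  qed
  define b where "b j k = Re (\<integral>x. h j x * F k x \<partial>lebesgue)" for j k
  have b_bound: "\<bar>b j k\<bar> \<le> \<nu> k" for j k
  proof -
    have "\<bar>b j k\<bar> \<le> l2_norm lebesgue (h j) * \<nu> k"
      unfolding b_def \<nu>_def using abs_Re_le_cmod integral_Cauchy_Schwarz[OF h F] by (rule order_trans)
    also have "\<dots> \<le> 1 * \<nu> k"
      using \<nu>_pos[of k] by (intro mult_right_mono h_norm) auto
    finally show ?thesis by simp
  qed
  have b_diag: "b k k = \<nu> k" for k
  proof -
    have "h k x * F k x = of_real ((cmod (F k x))\<^sup>2) / of_real (\<nu> k)" for x
      unfolding complex_norm_square by (simp add: h_def mult.commute)
    then have "(\<integral>x. h k x * F k x \<partial>lebesgue)
        = (\<integral>x. of_real ((cmod (F k x))\<^sup>2) / of_real (\<nu> k) \<partial>lebesgue)"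
      by simp
    also have "\<dots> = of_real ((\<nu> k)\<^sup>2) / of_real (\<nu> k)"
      unfolding \<nu>_def l2_norm_power2 integral_divide_zero integral_complex_of_real ..
    also have "\<dots> = of_real (\<nu> k)"
      using \<nu>_pos[of k] by (simp add: power2_eq_square)
    finally show ?thesis
      by (simp add: b_def)
  qed
  obtain s where s: "\<And>j. \<bar>s j\<bar> = 1"
    and s_large: "\<And>k. \<bar>b k k\<bar> / 3 ^ k \<le> \<bar>\<Sum>j\<le>k. s j * b j k / 3 ^ j\<bar>"
    by (rule reinforcing_sign_choice[of b]) blast
  have geo: "summable (\<lambda>j. (1 / 3 :: real) ^ j)"
    by (rule summable_geometric) simp
  have abs_s: "\<bar>s j / 3 ^ j\<bar> = (1 / 3) ^ j" for j
    using s[of j] by (simp add: power_divide)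
  define \<phi> where "\<phi> p = (\<Sum>j. s j / 3 ^ j * Re (\<integral>x. h j x * fst p x \<partial>lebesgue))"
    for p :: "('a \<Rightarrow> complex) \<times> 'a"
  have "bounded_functional U \<phi>"
    unfolding \<phi>_def by (rule bounded_functional_series[OF h h_norm]) (simp only: abs_s geo)
  then have "(\<lambda>n. \<phi> (p n)) \<longlonglongrightarrow> \<phi> q"
    using conv by (simp add: weakly_converges_def)
  then have "Bseq (\<lambda>n. \<phi> (p n))"
    by (intro convergent_imp_Bseq convergentI)
  then obtain C where C: "\<And>n. \<bar>\<phi> (p n)\<bar> \<le> C"
    by (auto simp: Bseq_def)
  have "real k \<le> C" for k
  proof -
    define a where "a j = s j / 3 ^ j * b j k" for j
    have a_bound: "\<bar>a j\<bar> \<le> (1 / 3) ^ j * \<nu> k" for j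
      unfolding a_def abs_mult abs_s using b_bound by (intro mult_left_mono) auto
    have abs_a: "summable (\<lambda>j. \<bar>a j\<bar>)"
      by (rule summable_comparison_test'[OF summable_mult2[OF geo], of 0 _ "\<nu> k"]) (use a_bound in auto)
    have a: "summable a"
      using abs_a by (rule summable_rabs_cancel)
    have "\<bar>\<Sum>j. a (j + Suc k)\<bar> \<le> (\<Sum>j. \<bar>a (j + Suc k)\<bar>)"
      using abs_a by (intro summable_rabs) (subst summable_iff_shift)
    also have "\<dots> \<le> (\<Sum>j. (1 / 3) ^ j * ((1 / 3) ^ Suc k * \<nu> k))"
    proof (rule suminf_le)
      show "\<bar>a (j + Suc k)\<bar> \<le> (1 / 3) ^ j * ((1 / 3) ^ Suc k * \<nu> k)" for j
        using a_bound[of "j + Suc k"] unfolding power_add by (simp only: mult.assoc)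
      show "summable (\<lambda>j. \<bar>a (j + Suc k)\<bar>)"
        using abs_a by (subst summable_iff_shift)
    qed (intro summable_mult2 geo)
    also have "\<dots> = \<nu> k / 3 ^ k / 2"
      unfolding suminf_mult2[OF geo, symmetric] by (simp add: suminf_geometric power_divide)
    finally have tail: "\<bar>\<Sum>j. a (j + Suc k)\<bar> \<le> \<nu> k / 3 ^ k / 2" .
    have head: "\<nu> k / 3 ^ k \<le> \<bar>\<Sum>j\<le>k. a j\<bar>"
      using s_large[of k] \<nu>_pos[of k] by (simp add: b_diag a_def)
    have "real k < \<nu> k / 3 ^ k / 2"
      using \<nu>_large[of k] by (simp add: field_simps)
    also have "\<dots> \<le> \<bar>\<Sum>j\<le>k. a j\<bar> - \<bar>\<Sum>j. a (j + Suc k)\<bar>"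
      using head tail by linarith
    also have "\<dots> \<le> \<bar>(\<Sum>j. a (j + Suc k)) + (\<Sum>j\<le>k. a j)\<bar>"
      by linarith
    also have "(\<Sum>j. a (j + Suc k)) + (\<Sum>j\<le>k. a j) = suminf a"
      using suminf_split_initial_segment[OF a, of "Suc k"] by (simp add: lessThan_Suc_atMost)
    also have "suminf a = \<phi> (p (N k))"
      by (simp add: \<phi>_def a_def[abs_def] b_def F_def)
    also have "\<bar>\<phi> (p (N k))\<bar> \<le> C"
      by (rule C)
    finally show ?thesis by simp
  qed
  then show False
    using reals_Archimedean2[of C] by (meson not_le)
qed

section \<open>Weak continuity of Hilbert-Schmidt forms\<close>

lemma square_integrable_iff_nn_integral:
  assumes "f \<in> borel_measurable M"
  shows "square_integrable M f \<longleftrightarrow> (\<integral>\<^sup>+x. ennreal ((cmod (f x))\<^sup>2) \<partial>M) < \<infinity>"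
  using assms by (auto simp: square_integrable_def integrable_iff_bounded)

lemma (in pair_sigma_finite) square_integrable_tensor:
  assumes f: "square_integrable M1 f" and g: "square_integrable M2 g"
  shows "square_integrable (M1 \<Otimes>\<^sub>M M2) (\<lambda>p. f (fst p) * g (snd p))"
proof -
  have [measurable]: "f \<in> borel_measurable M1" "g \<in> borel_measurable M2"
    using assms by auto
  have "(\<integral>\<^sup>+p. ennreal ((cmod (f (fst p) * g (snd p)))\<^sup>2) \<partial>(M1 \<Otimes>\<^sub>M M2))
      = (\<integral>\<^sup>+x. \<integral>\<^sup>+y. ennreal ((cmod (f x))\<^sup>2) * ennreal ((cmod (g y))\<^sup>2) \<partial>M2 \<partial>M1)"
    by (subst M2.nn_integral_fst[symmetric])
       (auto simp: norm_mult power_mult_distrib ennreal_mult)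
  also have "\<dots> = (\<integral>\<^sup>+x. ennreal ((cmod (f x))\<^sup>2) \<partial>M1) * (\<integral>\<^sup>+y. ennreal ((cmod (g y))\<^sup>2) \<partial>M2)"
    by (simp add: nn_integral_cmult nn_integral_multc)
  also have "\<dots> < \<infinity>"
    using f g square_integrable_iff_nn_integral[of f M1] square_integrable_iff_nn_integral[of g M2]
    by (simp add: ennreal_mult_less_top)
  finally show ?thesis
    by (subst square_integrable_iff_nn_integral) measurable
qed

text \<open>
  Let \<open>G w\<close> be the image of \<open>w\<close> under the integral operator with kernel \<open>k\<close>. Almost every slice of \<open>k\<close>
  is square integrable, so weak convergence gives \<open>G (v n) \<longlonglongrightarrow> G v'\<close> pointwise almost everywhere. The bound
  on the norms gives a square-integrable majorant, whence \<open>G (v n) \<longlonglongrightarrow> G v'\<close> in \<open>L\<^sup>2\<close>. A strongly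
  convergent sequence paired with a bounded, weakly convergent one converges.
\<close>

lemma (in pair_sigma_finite) Hilbert_Schmidt_form_tendsto:
  assumes k: "square_integrable (M1 \<Otimes>\<^sub>M M2) k"
    and u: "\<And>n. square_integrable M1 (u n)" "square_integrable M1 u'"
    and v: "\<And>n. square_integrable M2 (v n)" "square_integrable M2 v'"
    and u_bound: "\<And>n. l2_norm M1 (u n) \<le> K"
    and v_bound: "\<And>n. l2_norm M2 (v n) \<le> K"
    and u_weak: "\<And>h. square_integrable M1 h \<Longrightarrow> (\<lambda>n. \<integral>x. h x * u n x \<partial>M1) \<longlonglongrightarrow> (\<integral>x. h x * u' x \<partial>M1)"
    and v_weak: "\<And>h. square_integrable M2 h \<Longrightarrow> (\<lambda>n. \<integral>y. h y * v n y \<partial>M2) \<longlonglongrightarrow> (\<integral>y. h y * v' y \<partial>M2)"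
  shows "(\<lambda>n. \<integral>p. u n (fst p) * v n (snd p) * k p \<partial>(M1 \<Otimes>\<^sub>M M2))
    \<longlonglongrightarrow> (\<integral>p. u' (fst p) * v' (snd p) * k p \<partial>(M1 \<Otimes>\<^sub>M M2))"
proof -
  have [measurable]: "k \<in> borel_measurable (M1 \<Otimes>\<^sub>M M2)"
    using k by auto
  have [measurable]: "u n \<in> borel_measurable M1" "v n \<in> borel_measurable M2" for n
    using u v by auto
  have [measurable]: "u' \<in> borel_measurable M1" "v' \<in> borel_measurable M2"
    using u v by auto
  define \<kappa> where "\<kappa> x = (\<integral>y. (cmod (k (x, y)))\<^sup>2 \<partial>M2)" for x
  have \<kappa>: "integrable M1 \<kappa>"
    unfolding \<kappa>_def using integrable_fst'[OF square_integrableD(2)[OF k]] .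
  have slice: "AE x in M1. square_integrable M2 (\<lambda>y. k (x, y))"
    using AE_integrable_fst'[OF square_integrableD(2)[OF k]] AE_space
    by eventually_elim (simp add: square_integrable_def)
  define G where "G w x = (\<integral>y. k (x, y) * w y \<partial>M2)" for w x
  have [measurable]: "G w \<in> borel_measurable M1" if [measurable]: "w \<in> borel_measurable M2" for w
    unfolding G_def by measurable
  have fubini: "(\<integral>p. a (fst p) * b (snd p) * k p \<partial>(M1 \<Otimes>\<^sub>M M2)) = (\<integral>x. G b x * a x \<partial>M1)"
    if "square_integrable M1 a" "square_integrable M2 b" for a b
  proof -
    have "(\<integral>p. a (fst p) * b (snd p) * k p \<partial>(M1 \<Otimes>\<^sub>M M2))
        = (\<integral>x. \<integral>y. a x * b y * k (x, y) \<partial>M2 \<partial>M1)"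
      using integral_fst'[OF square_integrable_times[OF square_integrable_tensor[OF that] k]] by simp
    moreover have "(\<integral>y. a x * b y * k (x, y) \<partial>M2) = G b x * a x" for x
      unfolding G_def integral_mult_left_zero[symmetric] by (simp add: mult_ac)
    ultimately show ?thesis by simp
  qed
  have G_bound: "AE x in M1. cmod (G w x) \<le> l2_norm M2 w * sqrt (\<kappa> x)"
    if "square_integrable M2 w" for w
    using slice
  proof eventually_elim
    case (elim x)
    then show ?case
      using integral_Cauchy_Schwarz[OF elim that] by (simp add: G_def l2_norm_def \<kappa>_def mult.commute)
  qed
  have \<kappa>_nonneg: "0 \<le> \<kappa> x" for x
    by (simp add: \<kappa>_def)
  have sqrt_\<kappa>: "square_integrable M1 (\<lambda>x. of_real (sqrt (\<kappa> x)))"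
    using \<kappa> \<kappa>_nonneg by (simp add: square_integrable_def)
  have G: "square_integrable M1 (G w)" if "square_integrable M2 w" for w
    by (rule square_integrable_bound[OF sqrt_\<kappa>, of _ "l2_norm M2 w"])
       (use G_bound[OF that] that \<kappa>_nonneg in auto)
  define L where "L = max K (l2_norm M2 v')"
  have L: "l2_norm M2 (v n) \<le> L" "l2_norm M2 v' \<le> L" for n
    using v_bound[of n] by (auto simp: L_def)
  define D where "D n x = G (v n) x - G v' x" for n x
  have D: "square_integrable M1 (D n)" for n
    unfolding D_def by (intro square_integrable_diff G v)
  have "(\<lambda>n. \<integral>x. (cmod (D n x))\<^sup>2 \<partial>M1) \<longlonglongrightarrow> (\<integral>x. 0 \<partial>M1)"
  proof (rule integral_dominated_convergence)
    \<comment> \<open>Cauchy-Schwarz on a slice bounds each of the two terms of \<open>D n x\<close> by \<open>L * sqrt (\<kappa> x)\<close>.\<close>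
    show "integrable M1 (\<lambda>x. 4 * L\<^sup>2 * \<kappa> x)"
      using \<kappa> by simp
    show "AE x in M1. (\<lambda>n. (cmod (D n x))\<^sup>2) \<longlonglongrightarrow> 0"
      using slice
    proof eventually_elim
      case (elim x)
      have "(\<lambda>n. D n x) \<longlonglongrightarrow> 0"
        using v_weak[OF elim] unfolding D_def G_def by (simp add: LIM_zero)
      then have "(\<lambda>n. (cmod (D n x))\<^sup>2) \<longlonglongrightarrow> (cmod 0)\<^sup>2"
        by (intro tendsto_power tendsto_norm)
      then show ?case by simp
    qed
    show "AE x in M1. norm ((cmod (D n x))\<^sup>2) \<le> 4 * L\<^sup>2 * \<kappa> x" for n
      using G_bound[OF v(1)[of n]] G_bound[OF v(2)]
    proof eventually_elim
      case (elim x)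
      have "cmod (D n x) \<le> cmod (G (v n) x) + cmod (G v' x)"
        unfolding D_def by (rule norm_triangle_ineq4)
      also have "\<dots> \<le> L * sqrt (\<kappa> x) + L * sqrt (\<kappa> x)"
        using elim L \<kappa>_nonneg[of x] by (intro add_mono) (meson mult_right_mono order_trans real_sqrt_ge_zero)+
      finally have "(cmod (D n x))\<^sup>2 \<le> (2 * L * sqrt (\<kappa> x))\<^sup>2"
        by (intro power_mono) auto
      then show ?case
        using \<kappa>_nonneg[of x] by (simp add: power_mult_distrib)
    qed
  qed (simp_all add: D_def)
  then have "(\<lambda>n. sqrt (\<integral>x. (cmod (D n x))\<^sup>2 \<partial>M1)) \<longlonglongrightarrow> sqrt 0"
    by (intro tendsto_real_sqrt) simp
  then have D_norm: "(\<lambda>n. l2_norm M1 (D n)) \<longlonglongrightarrow> 0"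
    by (simp add: l2_norm_def)
  have "(\<lambda>n. \<integral>x. D n x * u n x \<partial>M1) \<longlonglongrightarrow> 0"
  proof (rule Lim_null_comparison)
    show "\<forall>\<^sub>F n in sequentially. norm (\<integral>x. D n x * u n x \<partial>M1) \<le> l2_norm M1 (D n) * K"
      using integral_Cauchy_Schwarz[OF D u(1)] u_bound
      by (intro always_eventually allI) (meson l2_norm_nonneg mult_left_mono order_trans)
    show "(\<lambda>n. l2_norm M1 (D n) * K) \<longlonglongrightarrow> 0"
      using tendsto_mult_right[OF D_norm, of K] by simp
  qed
  then have "(\<lambda>n. (\<integral>x. D n x * u n x \<partial>M1) + (\<integral>x. G v' x * u n x \<partial>M1)) \<longlonglongrightarrow> 0 + (\<integral>x. G v' x * u' x \<partial>M1)"
    by (intro tendsto_add u_weak G v)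
  moreover have "(\<integral>x. D n x * u n x \<partial>M1) + (\<integral>x. G v' x * u n x \<partial>M1) = (\<integral>x. G (v n) x * u n x \<partial>M1)" for n
    using square_integrable_times[OF D u(1), of n n] square_integrable_times[OF G[OF v(2)] u(1), of n]
    by (subst Bochner_Integration.integral_add[symmetric]) (simp_all add: D_def algebra_simps)
  ultimately show ?thesis
    using u v by (simp add: fubini)
qed

section \<open>Borel representatives\<close>

lemma borel_representative:
  fixes f :: "'a \<Rightarrow> complex"
  assumes f: "f \<in> borel_measurable (completion M)"
  obtains f' where "f' \<in> borel_measurable M" "AE x in M. f x = f' x"
proof -
  have "(\<lambda>x. Re (f x)) \<in> borel_measurable (completion M)" "(\<lambda>x. Im (f x)) \<in> borel_measurable (completion M)"
    using f by measurable
  from this[THEN completion_ex_borel_measurable_real] obtain a b where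
    [measurable]: "a \<in> borel_measurable M" "b \<in> borel_measurable M"
    and ab: "AE x in M. Re (f x) = a x" "AE x in M. Im (f x) = b x"
    by blast
  show thesis
  proof
    show "(\<lambda>x. Complex (a x) (b x)) \<in> borel_measurable M"
      unfolding Complex_eq by measurable
    show "AE x in M. f x = Complex (a x) (b x)"
      using ab by eventually_elim (simp add: complex_eq_iff)
  qed
qed

lemma measurable_completion_AE_cong:
  fixes f g :: "'a \<Rightarrow> complex"
  assumes g: "g \<in> borel_measurable M" and eq: "AE x in M. f x = g x"
  shows "f \<in> borel_measurable (completion M)"
proof (rule measurableI)
  fix A :: "complex set" assume "A \<in> sets borel"
  then have "g -` A \<inter> space (completion M) \<in> sets (completion M)"
    using measurable_sets[OF g] by auto
  moreover have "AE x in completion M. x \<in> g -` A \<inter> space (completion M) \<longleftrightarrow> x \<in> f -` A \<inter> space (completion M)"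
    using AE_completion[OF eq] by eventually_elim auto
  ultimately show "f -` A \<inter> space (completion M) \<in> sets (completion M)"
    using completion.in_sets_AE by (metis Int_lower2)
qed simp

lemma integral_completion_AE_cong:
  fixes f g :: "'a \<Rightarrow> complex"
  assumes g: "g \<in> borel_measurable M" and eq: "AE x in M. f x = g x"
  shows "(\<integral>x. f x \<partial>completion M) = (\<integral>x. g x \<partial>M)"
    and "integrable (completion M) f \<longleftrightarrow> integrable M g"
proof -
  note [measurable] = measurable_completion_AE_cong[OF assms] measurable_completion[OF g]
  have "(\<integral>x. f x \<partial>completion M) = (\<integral>x. g x \<partial>completion M)"
    using AE_completion[OF eq] by (intro integral_cong_AE) auto
  then show "(\<integral>x. f x \<partial>completion M) = (\<integral>x. g x \<partial>M)"
    using g by (simp add: integral_completion)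
  have "integrable (completion M) f \<longleftrightarrow> integrable (completion M) g"
    using AE_completion[OF eq] by (intro integrable_cong_AE) auto
  then show "integrable (completion M) f \<longleftrightarrow> integrable M g"
    using g by (simp add: integrable_completion)
qed

lemma square_integrable_completion_AE_cong:
  fixes f g :: "'a \<Rightarrow> complex"
  assumes g: "g \<in> borel_measurable M" and eq: "AE x in M. f x = g x"
  shows "square_integrable (completion M) f \<longleftrightarrow> square_integrable M g"
    and "l2_norm (completion M) f = l2_norm M g"
proof -
  have "(\<lambda>x. complex_of_real ((cmod (g x))\<^sup>2)) \<in> borel_measurable M"
    using g by measurable
  moreover have "AE x in M. complex_of_real ((cmod (f x))\<^sup>2) = complex_of_real ((cmod (g x))\<^sup>2)"
    using eq by eventually_elim simp
  ultimately have "(\<integral>x. (cmod (f x))\<^sup>2 \<partial>completion M) = (\<integral>x. (cmod (g x))\<^sup>2 \<partial>M)"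
    and "integrable (completion M) (\<lambda>x. (cmod (f x))\<^sup>2) \<longleftrightarrow> integrable M (\<lambda>x. (cmod (g x))\<^sup>2)"
    using integral_completion_AE_cong[of "\<lambda>x. complex_of_real ((cmod (g x))\<^sup>2)" M
        "\<lambda>x. complex_of_real ((cmod (f x))\<^sup>2)"]
    unfolding integral_complex_of_real complex_of_real_integrable_eq by simp_all
  then show "square_integrable (completion M) f \<longleftrightarrow> square_integrable M g"
    and "l2_norm (completion M) f = l2_norm M g"
    using g measurable_completion_AE_cong[OF assms] by (simp_all add: square_integrable_def l2_norm_def)
qed

section \<open>Translations and the shear\<close>

text \<open>
  The substitution that turns the correlation integral, over \<open>x\<close> and \<open>y\<close>, into an integral over the
  two arguments \<open>x + y\<close> and \<open>y\<close> of the weight.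
\<close>

definition shear :: "'a::euclidean_space \<times> 'a \<Rightarrow> 'a \<times> 'a" where
  "shear p = (fst p + snd p, snd p)"

lemma measurable_shear [measurable]: "shear \<in> borel_measurable borel"
  unfolding shear_def by (intro borel_measurable_continuous_onI continuous_intros)

text \<open>
  Every horizontal slice is only translated by the shear, so the two measures agree by Cavalieri's
  principle.
\<close>

lemma distr_shear: "distr lborel lborel shear = (lborel :: ('a::euclidean_space \<times> 'a) measure)"
proof (rule measure_eqI)
  fix A :: "('a \<times> 'a) set"
  assume "A \<in> sets (distr lborel lborel shear)"
  then have A [measurable]: "A \<in> sets borel"
    by simp
  then have A': "A \<in> sets ((lborel :: 'a measure) \<Otimes>\<^sub>M (lborel :: 'a measure))"
    by (metis lborel_prod sets_lborel)
  have B: "shear -` A \<in> sets borel"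
    using measurable_sets[OF measurable_shear A] by simp
  then have B': "shear -` A \<in> sets ((lborel :: 'a measure) \<Otimes>\<^sub>M (lborel :: 'a measure))"
    by (metis lborel_prod sets_lborel)
  have slice [measurable]: "(\<lambda>x. (x, y)) -` A \<in> sets borel" for y
    using sets_Pair2[OF A', of y] by simp
  have "emeasure lborel ((\<lambda>x. (x, y)) -` shear -` A) = emeasure lborel ((\<lambda>x. (x, y)) -` A)" for y :: 'a
  proof -
    have "emeasure lborel ((\<lambda>x. (x, y)) -` A) = emeasure (distr lborel borel ((+) y)) ((\<lambda>x. (x, y)) -` A)"
      by (simp add: lborel_distr_plus)
    also have "\<dots> = emeasure lborel ((\<lambda>x. (x, y)) -` shear -` A)"
      by (subst emeasure_distr) (auto simp: shear_def vimage_def add.commute)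
    finally show ?thesis by simp
  qed
  then show "emeasure (distr lborel lborel shear) A = emeasure lborel A"
    using lborel_pair.emeasure_pair_measure_alt2[OF A'] lborel_pair.emeasure_pair_measure_alt2[OF B'] B
    by (simp add: emeasure_distr lborel_prod)
qed simp

lemma square_integrable_shear:
  assumes "h \<in> borel_measurable borel"
  shows "square_integrable lborel (\<lambda>p. h (shear p)) \<longleftrightarrow> square_integrable lborel h"
proof -
  note [measurable] = assms
  have "integrable lborel (\<lambda>p. (cmod (h (shear p)))\<^sup>2) \<longleftrightarrow> integrable (distr lborel lborel shear) (\<lambda>p. (cmod (h p))\<^sup>2)"
    by (subst integrable_distr_eq) auto
  then show ?thesis
    unfolding distr_shear by (simp add: square_integrable_def)
qed

lemma square_integrable_translate:
  fixes f :: "'a::euclidean_space \<Rightarrow> complex"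
  assumes f: "square_integrable lborel f"
  shows "square_integrable lborel (\<lambda>y. f (x + y))" and "l2_norm lborel (\<lambda>y. f (x + y)) = l2_norm lborel f"
proof -
  have [measurable]: "f \<in> borel_measurable borel"
    using f by (auto simp: square_integrable_def)
  have "integrable lborel (\<lambda>y. (cmod (f (x + y)))\<^sup>2) \<longleftrightarrow> integrable (distr lborel borel ((+) x)) (\<lambda>y. (cmod (f y))\<^sup>2)"
    by (subst integrable_distr_eq) auto
  then show "square_integrable lborel (\<lambda>y. f (x + y))"
    using f by (simp add: square_integrable_def lborel_distr_plus)
  have "(\<integral>y. (cmod (f (x + y)))\<^sup>2 \<partial>lborel) = (\<integral>y. (cmod (f y))\<^sup>2 \<partial>distr lborel borel ((+) x))"
    by (subst integral_distr) auto
  then show "l2_norm lborel (\<lambda>y. f (x + y)) = l2_norm lborel f"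
    by (simp add: l2_norm_def lborel_distr_plus)
qed

lemma square_integrable_indicator_cball:
  "square_integrable lborel (indicator (cball (0::'a::euclidean_space) R))"
proof -
  have "(cmod (indicator (cball 0 R) x))\<^sup>2 = indicator (cball 0 R) x" for x :: 'a
    by (simp add: indicator_def)
  moreover have "integrable lborel (indicator (cball (0::'a) R) :: 'a \<Rightarrow> real)"
    by (intro integrable_real_indicator emeasure_bounded_finite) auto
  moreover have "(indicator (cball 0 R) :: 'a \<Rightarrow> complex) \<in> borel_measurable borel"
    by (intro borel_measurable_indicator) simp
  ultimately show ?thesis
    by (simp add: square_integrable_def)
qed

section \<open>The weighted autocorrelation\<close>

text \<open>
  A Borel weight with bound and support made explicit. The set \<open>U\<close> is replaced by a ball around it,
  because \<open>U\<close> need not be a Borel set.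
\<close>

definition truncated_borel_weight :: "real \<Rightarrow> real \<Rightarrow> ('a::euclidean_space \<Rightarrow> 'a \<Rightarrow> complex) \<Rightarrow> bool" where
  "truncated_borel_weight B R w \<longleftrightarrow> (\<lambda>p. w (fst p) (snd p)) \<in> borel_measurable borel \<and>
     (\<forall>z y. cmod (w z y) \<le> B * (indicator (cball 0 R) z * indicator (cball 0 R) y))"

text \<open>
  Outside the range allowed by the bound and the ball, a Borel representative differs from \<open>w\<close>, so
  setting it to zero there changes it on a null set only.
\<close>

lemma weight_representative:
  assumes "w \<in> W U" and "bounded U"
  obtains w' B R where "0 \<le> B" "truncated_borel_weight B R w'"
    "AE p in lborel. w (fst p) (snd p) = w' (fst p) (snd p)"
proof -
  have w: "(\<lambda>p. w (fst p) (snd p)) \<in> borel_measurable lebesgue"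
    and bdd: "bounded (range (\<lambda>p. w (fst p) (snd p)))"
    using assms(1) by (auto simp: W_def bounded_measurable_def case_prod_unfold)
  have supp: "w z y = 0" if "z \<notin> U \<or> y \<notin> U" for z y
    using assms(1) that by (auto simp: W_def bounded_measurable_def)
  obtain B where B: "\<And>z y. cmod (w z y) \<le> B"
    using bdd unfolding bounded_iff by fastforce
  obtain R where R: "\<And>z. z \<in> U \<Longrightarrow> norm z \<le> R"
    using assms(2) by (auto simp: bounded_iff)
  obtain v where v [measurable]: "v \<in> borel_measurable lborel" and eq: "AE p in lborel. w (fst p) (snd p) = v p"
    using borel_representative[OF w] by blast
  define w' where
    "w' z y = (if cmod (v (z, y)) \<le> B \<and> norm z \<le> R \<and> norm y \<le> R then v (z, y) else 0)" for z y
  show thesis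
  proof
    show "0 \<le> B"
      using B[of 0 0] norm_ge_zero order_trans by blast
    have [measurable]: "(fst :: 'a \<times> 'a \<Rightarrow> 'a) \<in> borel_measurable borel"
      "(snd :: 'a \<times> 'a \<Rightarrow> 'a) \<in> borel_measurable borel"
      by (intro borel_measurable_continuous_onI continuous_intros)+
    have "(\<lambda>p. if cmod (v p) \<le> B \<and> norm (fst p) \<le> R \<and> norm (snd p) \<le> R then v p else 0)
        \<in> borel_measurable borel"
      using v unfolding measurable_lborel1 by measurable
    then show "truncated_borel_weight B R w'"
      using \<open>0 \<le> B\<close> by (auto simp: truncated_borel_weight_def w'_def indicator_def)
    show "AE p in lborel. w (fst p) (snd p) = w' (fst p) (snd p)"
      using eq
    proof eventually_elim
      case (elim p)
      then show ?case
        using B[of "fst p" "snd p"] R[of "fst p"] R[of "snd p"] supp[of "fst p" "snd p"]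
        by (cases "fst p \<in> U \<and> snd p \<in> U") (auto simp: w'_def)
    qed
  qed
qed

text \<open>
  For a fixed \<open>x\<close> the weight is evaluated on the null set \<open>{(x + y, y) | y. True}\<close>, where equality
  almost everywhere says nothing. It does hold for almost every \<open>x\<close>, as the preimage of a null set
  under the shear is a null set, almost all slices of which are null.
\<close>

lemma xcorr_integrand_AE_cong:
  assumes f: "AE y in lborel. f y = f' y" and w: "AE p in lborel. w (fst p) (snd p) = w' (fst p) (snd p)"
  shows "AE x in lborel. AE y in lborel. xcorr_integrand w f f x y = xcorr_integrand w' f' f' x y"
proof -
  have "AE p in distr lborel lborel shear. w (fst p) (snd p) = w' (fst p) (snd p)"
    unfolding distr_shear by fact
  then have "AE p in lborel. w (fst (shear p)) (snd (shear p)) = w' (fst (shear p)) (snd (shear p))"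
    by (rule AE_distrD[rotated]) simp
  then have "AE p in lborel \<Otimes>\<^sub>M lborel.
      w (fst (shear p)) (snd (shear p)) = w' (fst (shear p)) (snd (shear p))"
    unfolding lborel_prod .
  from lborel_pair.AE_pair[OF this]
  have "AE x in lborel. AE y in lborel. w (x + y) y = w' (x + y) y"
    by (simp add: shear_def)
  then show ?thesis
  proof eventually_elim
    case (elim x)
    have "AE y in distr lborel borel ((+) x). f y = f' y"
      unfolding lborel_distr_plus by (rule f)
    then have "AE y in lborel. f (x + y) = f' (x + y)"
      by (rule AE_distrD[rotated]) simp
    with elim f show ?case
      by eventually_elim (simp add: xcorr_integrand_def)
  qed
qed

lemma measurable_sheared_weight:
  assumes "truncated_borel_weight B R w"
  shows "(\<lambda>p. w (fst p + snd p) (snd p)) \<in> borel_measurable borel"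
  using measurable_compose[OF measurable_shear, of "\<lambda>p. w (fst p) (snd p)"] assms
  by (simp add: shear_def truncated_borel_weight_def)

lemma measurable_xcorr_integrand:
  fixes f :: "'a::euclidean_space \<Rightarrow> complex"
  assumes [measurable]: "f \<in> borel_measurable borel" and w: "truncated_borel_weight B R w"
  shows "(\<lambda>p. xcorr_integrand w f f (fst p) (snd p)) \<in> borel_measurable (borel \<Otimes>\<^sub>M borel)"
proof -
  have [measurable]: "(\<lambda>p. w (fst p + snd p) (snd p)) \<in> borel_measurable (borel \<Otimes>\<^sub>M borel)"
    using measurable_sheared_weight[OF w] by (simp add: borel_prod)
  show ?thesis
    unfolding xcorr_integrand_def by measurable
qed

text \<open>
  The correlation is bounded, by Cauchy-Schwarz, and vanishes for \<open>norm x > 2 * R\<close>, since no two points of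
  the ball of radius \<open>R\<close> are farther apart than that. Hence it is square integrable.
\<close>

lemma xcorr_truncated:
  fixes f :: "'a::euclidean_space \<Rightarrow> complex"
  assumes f: "square_integrable lborel f" and w: "truncated_borel_weight B R w" and B: "0 \<le> B"
  shows "integrable lborel (xcorr_integrand w f f x)"
    and "xcorr w f f x = (\<integral>y. xcorr_integrand w f f x y \<partial>lborel)"
    and "square_integrable lborel (xcorr w f f)"
proof -
  have [measurable]: "f \<in> borel_measurable borel"
    using f by (auto simp: square_integrable_def)
  have meas: "(\<lambda>p. xcorr_integrand w f f (fst p) (snd p)) \<in> borel_measurable (lborel \<Otimes>\<^sub>M lborel)"
    using measurable_xcorr_integrand[OF _ w, of f] by (simp cong: measurable_cong_sets)
  have integrand [measurable]: "xcorr_integrand w f f x \<in> borel_measurable borel" for x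
    using measurable_compose[OF measurable_Pair1' meas] by simp
  show eq: "xcorr w f f x = (\<integral>y. xcorr_integrand w f f x y \<partial>lborel)" for x
    unfolding xcorr_def by (intro integral_completion) measurable
  have "(\<lambda>x. \<integral>y. xcorr_integrand w f f x y \<partial>lborel) \<in> borel_measurable lborel"
    using lborel.borel_measurable_lebesgue_integral[of "xcorr_integrand w f f" lborel] meas
    by (simp add: case_prod_unfold)
  then have xcorr_meas: "xcorr w f f \<in> borel_measurable lborel"
    by (subst eq[abs_def])
  have w_le: "cmod (w z y) \<le> B" for z y
  proof -
    have "B * (indicator (cball 0 R) z * indicator (cball 0 R) y) \<le> B * 1"
      using B by (intro mult_left_mono) (auto simp: indicator_def)
    then show ?thesis
      using w by (auto simp: truncated_borel_weight_def intro: order_trans)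
  qed
  define g where "g x y = f (x + y) * w (x + y) y" for x y
  have [measurable]: "g x \<in> borel_measurable lborel" for x
  proof -
    have "(\<lambda>y. w (x + y) y) \<in> borel_measurable borel"
      using measurable_compose[OF _ measurable_sheared_weight[OF w], of "\<lambda>y. (x, y)" borel]
      by (simp add: borel_prod[symmetric])
    then show ?thesis
      unfolding g_def by measurable
  qed
  have g_le: "AE y in lborel. cmod (g x y) \<le> B * cmod (f (x + y))" for x
    unfolding g_def norm_mult using mult_right_mono[OF w_le norm_ge_zero]
    by (intro AE_I2) (simp add: mult.commute)
  have g: "square_integrable lborel (g x)" for x
    by (rule square_integrable_bound[OF square_integrable_translate(1)[OF f] _ g_le]) measurable
  have g_norm: "l2_norm lborel (g x) \<le> B * l2_norm lborel f" for x
    using l2_norm_bound[OF square_integrable_translate(1)[OF f] _ B g_le, of x]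
    by (simp add: square_integrable_translate(2)[OF f])
  have integrand_eq: "xcorr_integrand w f f x = (\<lambda>y. cnj (f y) * g x y)" for x
    by (simp add: xcorr_integrand_def g_def fun_eq_iff mult.assoc)
  show "integrable lborel (xcorr_integrand w f f x)"
    unfolding integrand_eq by (intro square_integrable_times square_integrable_cnj f g)
  define C where "C = l2_norm lborel f * (B * l2_norm lborel f)"
  have "cmod (xcorr w f f x) \<le> C" for x
    unfolding eq integrand_eq C_def
    using integral_Cauchy_Schwarz[OF square_integrable_cnj[OF f] g, of x]
      mult_left_mono[OF g_norm l2_norm_nonneg, of lborel f x] by simp
  moreover have "xcorr w f f x = 0" if "norm x > 2 * R" for x
  proof -
    have "w (x + y) y = 0" for y
    proof -
      have "norm x \<le> norm (x + y) + norm y"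
        using norm_triangle_ineq4[of "x + y" y] by simp
      then have "B * (indicator (cball 0 R) (x + y) * indicator (cball 0 R) y) = 0"
        using that by (auto simp: indicator_def)
      then show ?thesis
        using w by (metis norm_le_zero_iff truncated_borel_weight_def)
    qed
    then show ?thesis
      by (simp add: eq xcorr_integrand_def)
  qed
  ultimately have "cmod (xcorr w f f x) \<le> C * cmod (indicator (cball 0 (2 * R)) x)" for x
    by (cases "norm x \<le> 2 * R") (auto simp: indicator_def)
  then show "square_integrable lborel (xcorr w f f)"
    by (intro square_integrable_bound[OF square_integrable_indicator_cball _ AE_I2] xcorr_meas)
qed

lemma xcorr_representative:
  fixes f f' :: "'a::euclidean_space \<Rightarrow> complex"
  assumes f': "square_integrable lborel f'" and w': "truncated_borel_weight B R w'" and B: "0 \<le> B"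
    and f: "AE y in lborel. f y = f' y" and w: "AE p in lborel. w (fst p) (snd p) = w' (fst p) (snd p)"
  shows "AE x in lborel. integrable lebesgue (xcorr_integrand w f f x)"
    and "AE x in lborel. xcorr w f f x = xcorr w' f' f' x"
proof -
  note * = xcorr_truncated[OF f' w' B]
  show "AE x in lborel. integrable lebesgue (xcorr_integrand w f f x)"
    using xcorr_integrand_AE_cong[OF f w]
  proof eventually_elim
    case (elim x)
    show ?case
      using integral_completion_AE_cong(2)[OF borel_measurable_integrable[OF *(1)] elim] *(1) by simp
  qed
  show "AE x in lborel. xcorr w f f x = xcorr w' f' f' x"
    using xcorr_integrand_AE_cong[OF f w]
  proof eventually_elim
    case (elim x)
    show ?case
      using integral_completion_AE_cong(1)[OF borel_measurable_integrable[OF *(1)] elim]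
      by (simp add: *(2) xcorr_def[of w])
  qed
qed

text \<open>
  Composed with the shear, \<open>k\<close> becomes \<open>r x * w (x + y) y\<close>, which is dominated by the tensor product of
  \<open>r\<close> and the indicator of a ball. This gives square integrability, and Fubini's theorem then
  gives the pairing.
\<close>

lemma xcorr_pairing_kernel:
  fixes r :: "'a::euclidean_space \<Rightarrow> complex"
  assumes r: "square_integrable lborel r" and w: "truncated_borel_weight B R w" and B: "0 \<le> B"
  defines "k \<equiv> (\<lambda>p. r (fst p - snd p) * w (fst p) (snd p))"
  shows "square_integrable lborel k"
    and "square_integrable lborel f \<Longrightarrow>
      (\<integral>x. r x * xcorr w f f x \<partial>lborel) = (\<integral>p. f (fst p) * cnj (f (snd p)) * k p \<partial>(lborel \<Otimes>\<^sub>M lborel))"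
proof -
  have r_meas: "r \<in> borel_measurable borel"
    using r by (auto simp: square_integrable_def)
  have w_meas: "(\<lambda>p. w (fst p) (snd p)) \<in> borel_measurable borel"
    using w by (simp add: truncated_borel_weight_def)
  have "(\<lambda>p::'a \<times> 'a. fst p - snd p) \<in> borel_measurable borel"
    by (intro borel_measurable_continuous_onI continuous_intros)
  from measurable_compose[OF this r_meas] have k_meas: "k \<in> borel_measurable borel"
    unfolding k_def by (intro borel_measurable_times w_meas)
  have tensor: "square_integrable lborel (\<lambda>p. r (fst p) * indicator (cball 0 R) (snd p))"
    using lborel_pair.square_integrable_tensor[OF r square_integrable_indicator_cball[of R]]
    unfolding lborel_prod .
  have k_le: "cmod (k (shear p)) \<le> B * cmod (r (fst p) * indicator (cball 0 R) (snd p))" for p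
  proof -
    have "cmod (w (fst p + snd p) (snd p)) \<le> B * (indicator (cball 0 R) (fst p + snd p) * indicator (cball 0 R) (snd p))"
      using w by (simp add: truncated_borel_weight_def)
    also have "\<dots> \<le> B * (1 * indicator (cball 0 R) (snd p))"
      using B by (intro mult_left_mono mult_right_mono) (auto simp: indicator_def)
    finally have "cmod (r (fst p)) * cmod (w (fst p + snd p) (snd p)) \<le> cmod (r (fst p)) * (B * indicator (cball 0 R) (snd p))"
      by (intro mult_left_mono) auto
    then show ?thesis
      by (cases "norm (snd p) \<le> R") (auto simp: k_def shear_def norm_mult mult.commute indicator_def)
  qed
  have "square_integrable lborel (\<lambda>p. k (shear p))"
  proof (rule square_integrable_bound[OF tensor _ AE_I2[OF k_le]])
    show "(\<lambda>p. k (shear p)) \<in> borel_measurable lborel"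
      using measurable_compose[OF measurable_shear k_meas] by simp
  qed
  then show k: "square_integrable lborel k"
    by (simp add: square_integrable_shear k_meas)
  assume f: "square_integrable lborel f"
  define H where "H p = f (fst p) * cnj (f (snd p)) * k p" for p
  have H: "integrable lborel H"
    using square_integrable_times[OF lborel_pair.square_integrable_tensor[OF f square_integrable_cnj[OF f]]] k
    unfolding H_def lborel_prod by blast
  then have "integrable (distr lborel lborel shear) H"
    unfolding distr_shear .
  then have H_shear: "integrable (lborel \<Otimes>\<^sub>M lborel) (\<lambda>p. H (shear p))"
    unfolding lborel_prod by (rule integrable_distr[rotated]) simp
  have "(\<integral>p. H p \<partial>(lborel \<Otimes>\<^sub>M lborel)) = (\<integral>p. H p \<partial>(distr lborel lborel shear))"
    unfolding distr_shear lborel_prod ..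
  also have "\<dots> = (\<integral>p. H (shear p) \<partial>lborel)"
    using borel_measurable_integrable[OF H] by (intro integral_distr) auto
  also have "\<dots> = (\<integral>x. \<integral>y. H (shear (x, y)) \<partial>lborel \<partial>lborel)"
    unfolding lborel_pair.integral_fst'[OF H_shear] lborel_prod ..
  also have "\<dots> = (\<integral>x. r x * xcorr w f f x \<partial>lborel)"
  proof -
    have "H (shear (x, y)) = r x * xcorr_integrand w f f x y" for x y
      by (simp add: H_def shear_def k_def xcorr_integrand_def mult_ac)
    then show ?thesis
      by (simp add: xcorr_truncated(2)[OF f w B])
  qed
  finally show "(\<integral>x. r x * xcorr w f f x \<partial>lborel) = (\<integral>p. f (fst p) * cnj (f (snd p)) * k p \<partial>(lborel \<Otimes>\<^sub>M lborel))"
    by (simp add: H_def)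
qed

text \<open>
  Both factors of the form \<open>f z * cnj (f y)\<close> have to converge weakly, so the conjugate is treated along
  with the function itself.
\<close>

lemma weak_limit_of_representatives:
  assumes conv: "weakly_converges U p q" and h: "square_integrable lborel h"
    and f: "\<And>n. f n \<in> borel_measurable lborel" "\<And>n. AE x in lborel. fst (p n) x = f n x"
    and g: "g \<in> borel_measurable lborel" "AE x in lborel. fst q x = g x"
  shows "(\<lambda>n. \<integral>x. h x * f n x \<partial>lborel) \<longlonglongrightarrow> (\<integral>x. h x * g x \<partial>lborel)"
    and "(\<lambda>n. \<integral>x. h x * cnj (f n x) \<partial>lborel) \<longlonglongrightarrow> (\<integral>x. h x * cnj (g x) \<partial>lborel)"
proof -
  have *: "(\<lambda>n. \<integral>x. h x * f n x \<partial>lborel) \<longlonglongrightarrow> (\<integral>x. h x * g x \<partial>lborel)"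
    if h: "square_integrable lborel h" for h
  proof -
    have [measurable]: "h \<in> borel_measurable lborel"
      using h by auto
    have eq: "(\<integral>x. h x * u x \<partial>lebesgue) = (\<integral>x. h x * v x \<partial>lborel)"
      if [measurable]: "v \<in> borel_measurable lborel" and "AE x in lborel. u x = v x" for u v
    proof (rule integral_completion_AE_cong)
      show "AE x in lborel. h x * u x = h x * v x"
        using that(2) by eventually_elim simp
    qed measurable
    have "square_integrable lebesgue h"
      using h by (subst square_integrable_completion_AE_cong(1)[of h]) auto
    then show ?thesis
      using weakly_converges_pairing[OF conv, of h] by (simp add: eq[OF f] eq[OF g])
  qed
  show "(\<lambda>n. \<integral>x. h x * f n x \<partial>lborel) \<longlonglongrightarrow> (\<integral>x. h x * g x \<partial>lborel)"
    by (rule *[OF h])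
  have "(\<integral>x. h x * cnj (u x) \<partial>lborel) = cnj (\<integral>x. cnj (h x) * u x \<partial>lborel)" for u
    using Bochner_Integration.integral_cnj[of lborel "\<lambda>x. cnj (h x) * u x"] by simp
  then show "(\<lambda>n. \<integral>x. h x * cnj (f n x) \<partial>lborel) \<longlonglongrightarrow> (\<integral>x. h x * cnj (g x) \<partial>lborel)"
    using tendsto_cnj[OF *[OF square_integrable_cnj[OF h]]] by simp
qed

lemma xcorr_pairing_tendsto:
  assumes w: "w \<in> W U" and U: "bounded U"
    and p: "\<And>n. fst (p n) \<in> L2 U" and q: "fst q \<in> L2 U" and conv: "weakly_converges U p q"
    and r: "square_integrable lebesgue r"
  shows "(\<lambda>n. \<integral>x. r x * xcorr w (fst (p n)) (fst (p n)) x \<partial>lebesgue)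
    \<longlonglongrightarrow> (\<integral>x. r x * xcorr w (fst q) (fst q) x \<partial>lebesgue)"
proof -
  obtain w' B R where B: "0 \<le> B" and w': "truncated_borel_weight B R w'"
    and w_eq: "AE p in lborel. w (fst p) (snd p) = w' (fst p) (snd p)"
    using weight_representative[OF w U] .
  obtain r' where r'_meas [measurable]: "r' \<in> borel_measurable lborel" and r_eq: "AE x in lborel. r x = r' x"
    using borel_representative r by blast
  have "\<exists>f'. f' \<in> borel_measurable lborel \<and> (AE x in lborel. fst (p n) x = f' x)" for n
    using borel_representative[of "fst (p n)" lborel] p[of n] by (auto simp: L2_def)
  then obtain f where f_meas: "\<And>n. f n \<in> borel_measurable lborel"
    and f_eq: "\<And>n. AE x in lborel. fst (p n) x = f n x"
    by metis
  obtain g where g_meas: "g \<in> borel_measurable lborel" and g_eq: "AE x in lborel. fst q x = g x"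
    using borel_representative[of "fst q" lborel] q by (auto simp: L2_def)
  have r': "square_integrable lborel r'"
    using r square_integrable_completion_AE_cong(1)[OF r'_meas r_eq] by simp
  have f: "square_integrable lborel (f n)" for n
    using p[of n] square_integrable_completion_AE_cong(1)[OF f_meas f_eq, of n]
    by (simp add: L2_iff_square_integrable)
  have g: "square_integrable lborel g"
    using q square_integrable_completion_AE_cong(1)[OF g_meas g_eq] by (simp add: L2_iff_square_integrable)
  obtain K where "\<And>n. l2_norm lebesgue (fst (p n)) \<le> K"
    using weakly_convergent_bounded[OF p conv] by blast
  then have K: "l2_norm lborel (f n) \<le> K" for n
    by (simp flip: square_integrable_completion_AE_cong(2)[OF f_meas f_eq])
  define k where "k p = r' (fst p - snd p) * w' (fst p) (snd p)" for p
  have k: "square_integrable (lborel \<Otimes>\<^sub>M lborel) k"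
    unfolding k_def lborel_prod by (rule xcorr_pairing_kernel(1)[OF r' w' B])
  have pairing: "(\<integral>x. r x * xcorr w u u x \<partial>lebesgue)
      = (\<integral>p. v (fst p) * cnj (v (snd p)) * k p \<partial>(lborel \<Otimes>\<^sub>M lborel))"
    if v: "square_integrable lborel v" and u: "AE x in lborel. u x = v x" for u v
  proof -
    have "(\<integral>x. r x * xcorr w u u x \<partial>lebesgue) = (\<integral>x. r' x * xcorr w' v v x \<partial>lborel)"
    proof (rule integral_completion_AE_cong)
      show "AE x in lborel. r x * xcorr w u u x = r' x * xcorr w' v v x"
        using r_eq xcorr_representative(2)[OF v w' B u w_eq] by eventually_elim simp
      show "(\<lambda>x. r' x * xcorr w' v v x) \<in> borel_measurable lborel"
        using xcorr_truncated(3)[OF v w' B] by (intro borel_measurable_times r'_meas) auto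
    qed
    then show ?thesis
      using xcorr_pairing_kernel(2)[OF r' w' B v] by (simp add: k_def)
  qed
  show ?thesis
    unfolding pairing[OF f f_eq] pairing[OF g g_eq]
  proof (rule lborel_pair.Hilbert_Schmidt_form_tendsto[where K = K])
    show "l2_norm lborel (\<lambda>x. cnj (f n x)) \<le> K" for n
      using K by simp
  qed (intro k f g K square_integrable_cnj weak_limit_of_representatives[OF conv] f_meas f_eq g_meas g_eq
        | assumption)+
qed

section \<open>The residual\<close>

lemma cmod_\<mu> [simp]: "cmod (\<mu> t x) = 1"
proof -
  have "\<mu> t x = exp (\<i> * of_real (2 * pi * (x \<bullet> t)))"
    by (simp add: \<mu>_def mult_ac)
  then show ?thesis
    by (simp only: norm_exp_i_times)
qed

lemma modulated_square_integrable:
  assumes "square_integrable lebesgue c"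
  shows "square_integrable lebesgue (\<lambda>x. \<mu> t x * c x)"
proof (rule square_integrable_bound[OF assms, where K = 1])
  have "\<mu> t \<in> borel_measurable borel"
    unfolding \<mu>_def by (intro borel_measurable_continuous_onI continuous_intros)
  then have "\<mu> t \<in> borel_measurable lebesgue"
    by (intro measurable_completion) simp
  then show "(\<lambda>x. \<mu> t x * c x) \<in> borel_measurable lebesgue"
    using assms by (intro borel_measurable_times) auto
qed (simp add: norm_mult)

lemma modulated_pairing_tendsto:
  assumes r: "square_integrable lebesgue r" and c: "square_integrable lebesgue c" and t: "t \<longlonglongrightarrow> t'"
  shows "(\<lambda>n. \<integral>x. r x * (\<mu> (t n) x * c x) \<partial>lebesgue) \<longlonglongrightarrow> (\<integral>x. r x * (\<mu> t' x * c x) \<partial>lebesgue)"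
proof (rule integral_dominated_convergence)
  show "integrable lebesgue (\<lambda>x. cmod (r x * c x))"
    by (intro integrable_norm square_integrable_times r c)
  show "AE x in lebesgue. (\<lambda>n. r x * (\<mu> (t n) x * c x)) \<longlonglongrightarrow> r x * (\<mu> t' x * c x)"
    unfolding \<mu>_def by (intro AE_I2 tendsto_intros t)
  show "AE x in lebesgue. norm (r x * (\<mu> (t n) x * c x)) \<le> cmod (r x * c x)" for n
    by (simp add: norm_mult)
qed (intro borel_measurable_integrable square_integrable_times r modulated_square_integrable c)+

lemma xcorr_square_integrable:
  assumes w: "w \<in> W U" and U: "bounded U" and f: "f \<in> L2 U"
  shows "AE x in lebesgue. integrable lebesgue (xcorr_integrand w f f x)"
    and "square_integrable lebesgue (xcorr w f f)"
proof -
  obtain w' B R where B: "0 \<le> B" and w': "truncated_borel_weight B R w'"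
    and w_eq: "AE p in lborel. w (fst p) (snd p) = w' (fst p) (snd p)"
    using weight_representative[OF w U] .
  obtain f' where f'_meas: "f' \<in> borel_measurable lborel" and f_eq: "AE x in lborel. f x = f' x"
    using borel_representative[of f lborel] f by (auto simp: L2_def)
  have f': "square_integrable lborel f'"
    using f square_integrable_completion_AE_cong(1)[OF f'_meas f_eq] by (simp add: L2_iff_square_integrable)
  note rep = xcorr_representative[OF f' w' B f_eq w_eq]
  have xcorr': "square_integrable lborel (xcorr w' f' f')"
    by (rule xcorr_truncated(3)[OF f' w' B])
  show "AE x in lebesgue. integrable lebesgue (xcorr_integrand w f f x)"
    by (rule AE_completion[OF rep(1)])
  show "square_integrable lebesgue (xcorr w f f)"
    using square_integrable_completion_AE_cong(1)[OF square_integrableD(1)[OF xcorr'] rep(2)] xcorr' by simp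
qed

lemma residual_square_integrable:
  assumes "w \<in> W U" and "bounded U" and "f \<in> L2 U" and "c \<in> L2 U"
  shows "square_integrable lebesgue (residual w c f t)"
  unfolding residual_def using assms
  by (intro square_integrable_diff xcorr_square_integrable(2)[of w U] modulated_square_integrable)
     (auto simp: L2_iff_square_integrable)

lemma residual_pairing:
  assumes "w \<in> W U" and "bounded U" and "f \<in> L2 U" and "c \<in> L2 U" and r: "square_integrable lebesgue r"
  shows "(\<integral>x. r x * residual w c f t x \<partial>lebesgue)
    = (\<integral>x. r x * xcorr w f f x \<partial>lebesgue) - (\<integral>x. r x * (\<mu> t x * c x) \<partial>lebesgue)"
  unfolding residual_def right_diff_distrib using assms
  by (intro Bochner_Integration.integral_diff square_integrable_times xcorr_square_integrable(2)[of w U]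
        modulated_square_integrable) (auto simp: L2_iff_square_integrable)

theorem proposition4p1:
  fixes U :: "(real ^ 'n) set" and c :: "real ^ 'n \<Rightarrow> complex"
    and w :: "real ^ 'n \<Rightarrow> real ^ 'n \<Rightarrow> complex"
  assumes "U \<in> sets lebesgue" and "bounded U"
    and "c \<in> L2 U" and "w \<in> W_plus U"
  shows "(\<forall>f\<in>L2 U. \<forall>t. (AE x in lebesgue. integrable lebesgue (xcorr_integrand w f f x))
              \<and> residual w c f t \<in> L2 UNIV)
         \<and> weakly_lsc U (\<lambda>(f, t). (L2_norm (residual w c f t))\<^sup>2)"
proof
  have w: "w \<in> W U"
    using \<open>w \<in> W_plus U\<close> by (simp add: W_plus_def)
  note residual = residual_square_integrable[OF w \<open>bounded U\<close> _ \<open>c \<in> L2 U\<close>]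
  show "\<forall>f\<in>L2 U. \<forall>t. (AE x in lebesgue. integrable lebesgue (xcorr_integrand w f f x))
      \<and> residual w c f t \<in> L2 UNIV"
    using xcorr_square_integrable(1)[OF w \<open>bounded U\<close>] residual by (simp add: L2_iff_square_integrable)
  show "weakly_lsc U (\<lambda>(f, t). (L2_norm (residual w c f t))\<^sup>2)"
    unfolding weakly_lsc_def
  proof (intro allI impI)
    fix p :: "nat \<Rightarrow> (real ^ 'n \<Rightarrow> complex) \<times> (real ^ 'n)" and q
    assume "\<forall>n. p n \<in> L2 U \<times> UNIV" and "q \<in> L2 U \<times> UNIV" and conv: "weakly_converges U p q"
    then have p: "\<And>n. fst (p n) \<in> L2 U" and q: "fst q \<in> L2 U"
      by (auto simp: mem_Times_iff)
    define \<rho> where "\<rho> z = residual w c (fst z) (snd z)" for z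
    have \<rho>: "square_integrable lebesgue (\<rho> q)" "square_integrable lebesgue (\<rho> (p n))" for n
      unfolding \<rho>_def by (intro residual p q)+
    have r: "square_integrable lebesgue (\<lambda>x. cnj (\<rho> q x))"
      by (rule square_integrable_cnj[OF \<rho>(1)])
    have c: "square_integrable lebesgue c"
      using \<open>c \<in> L2 U\<close> by (simp add: L2_iff_square_integrable)
    have pairing: "(\<integral>x. cnj (\<rho> q x) * \<rho> z x \<partial>lebesgue)
        = (\<integral>x. cnj (\<rho> q x) * xcorr w (fst z) (fst z) x \<partial>lebesgue)
          - (\<integral>x. cnj (\<rho> q x) * (\<mu> (snd z) x * c x) \<partial>lebesgue)" if "fst z \<in> L2 U" for z
      unfolding \<rho>_def[of z] by (rule residual_pairing[OF w \<open>bounded U\<close> that \<open>c \<in> L2 U\<close> r])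
    have "(\<lambda>n. \<integral>x. cnj (\<rho> q x) * \<rho> (p n) x \<partial>lebesgue) \<longlonglongrightarrow> (\<integral>x. cnj (\<rho> q x) * \<rho> q x \<partial>lebesgue)"
      using tendsto_diff[OF xcorr_pairing_tendsto[OF w \<open>bounded U\<close> p q conv r]
          modulated_pairing_tendsto[OF r c weakly_converges_snd[OF conv]]]
      unfolding pairing[OF p] pairing[OF q] .
    then have "(\<lambda>n. 2 * Re (\<integral>x. cnj (\<rho> q x) * \<rho> (p n) x \<partial>lebesgue) - (l2_norm lebesgue (\<rho> q))\<^sup>2)
        \<longlonglongrightarrow> 2 * (l2_norm lebesgue (\<rho> q))\<^sup>2 - (l2_norm lebesgue (\<rho> q))\<^sup>2"
      unfolding Re_integral_cnj_self[symmetric] by (intro tendsto_intros)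
    then have "ereal ((l2_norm lebesgue (\<rho> q))\<^sup>2)
        = liminf (\<lambda>n. ereal (2 * Re (\<integral>x. cnj (\<rho> q x) * \<rho> (p n) x \<partial>lebesgue)
            - (l2_norm lebesgue (\<rho> q))\<^sup>2))"
      by (intro lim_imp_Liminf[symmetric]) simp_all
    also have "\<dots> \<le> liminf (\<lambda>n. ereal ((l2_norm lebesgue (\<rho> (p n)))\<^sup>2))"
      by (intro Liminf_mono always_eventually allI) (simp add: l2_norm_power2_lower_bound \<rho>)
    finally show "ereal ((\<lambda>(f, t). (L2_norm (residual w c f t))\<^sup>2) q)
        \<le> liminf (\<lambda>n. ereal ((\<lambda>(f, t). (L2_norm (residual w c f t))\<^sup>2) (p n)))"
      by (simp add: \<rho>_def L2_norm_eq case_prod_unfold)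
  qed
qed

end
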